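(* Let $x_k\in\mathbb R^n$ and consider the (possibly nonconvex) cubic subproblem $$\min_{x\in\mathbb R^n}\ F_0(x_k)+\langle\nabla F_0(x_k),x-x_k\rangle+\tfrac12\langle\nabla^2F_0(x_k)(x-x_k),x-x_k\rangle+\tfrac{M_0}6\|x-x_k\|^3$$ subject to $F_i(x_k)+\langle\nabla F_i(x_k),x-x_k\rangle+\tfrac12\langle\nabla^2F_i(x_k)(x-x_k),x-x_k\rangle+\tfrac{M_i}6\|x-x_k\|^3\le0$, $i=1,\dots,m$. With $\theta,\beta,D,H,g,\tilde M$ as in the context, if there exists $M_i>0$ for some $i\in\{0,\dots,m\}$, then $$\theta^*:=\min_{x\in\mathbb R^n}\ \max_{u\ge0,\ u_0=1}\theta(x,u)=\max_{(u,w)\in D}\beta(u,w)=:\beta^*.$$ Moreover, for any $(u,w)\in D$ the direction $x(u,w)=x_k-H(u,w)^{-1}g(u)$ satisfies $$0\le\theta(x(u,w),u)-\beta(u,w)=\frac{\tilde M(u)}{12}\left(\frac w{\tilde M(u)}+2r_k\right)\left(r_k-\frac w{\tilde M(u)}\right)^2,$$ where $r_k=\|x(u,w)-x_k\|$.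
   Context: $F_0,F_1,\dots,F_m:\mathbb R^n\to\mathbb R$ are twice continuously differentiable, possibly nonconvex; $\|\cdot\|$ is the Euclidean norm, $I$ the identity. The subproblem is that of the MTA (moving Taylor approximation) method with $p=q=2$, $h=0$: the constants are $M_0=M_p+M$ and $M_i=M_q^i$, $i=1,\dots,m$, the regularization constants of the method (taken positive in the method). Notation, for $u=(u_0,u_1,\dots,u_m)\in\mathbb R^{m+1}_+$ with $u_0=1$ and $w\ge0$: $H(u,w)=\sum_{i=0}^mu_i\nabla^2F_i(x_k)+\frac w2I$, $g(u)=\sum_{i=0}^mu_i\nabla F_i(x_k)$, $l(u)=\sum_{i=0}^mu_iF_i(x_k)$, $\tilde M(u)=\sum_{i=0}^mu_iM_i$, $$\theta(x,u)=l(u)+\langle g(u),x-x_k\rangle+\tfrac12\Big\langle\Big(\sum_{i=0}^mu_i\nabla^2F_i(x_k)\Big)(x-x_k),x-x_k\Big\rangle+\frac{\tilde M(u)}6\|x-x_k\|^3,$$ $$\beta(u,w)=l(u)-\tfrac12\langle H(u,w)^{-1}g(u),g(u)\rangle-\frac{w^3}{12\,\tilde M(u)^2},$$ $$D=\Big\{(u_0,u_1,\dots,u_m,w)\in\mathbb R^{m+2}_+:\ u_0=1,\ \sum_{i=0}^mu_i\nabla^2F_i(x_k)+\tfrac w2I\succ0\Big\}.$$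
   Formalization: The equality θ* = β* is stated under the assumption that β attains its maximum on D (it can fail otherwise); without it, β* ≤ θ* and existence of the outer minimum are proved. All M_i ≥ 0 is assumed, and the gap formula is stated where M̃(u) ≠ 0. *)

theory Defs
  imports "HOL-Analysis.Analysis"
begin

section \<open>Derivatives of real functions on Euclidean n-space\<close>

definition grad :: "(real ^ 'n \<Rightarrow> real) \<Rightarrow> real ^ 'n \<Rightarrow> real ^ 'n" where
  "grad f x = (\<chi> j. frechet_derivative f (at x) (axis j 1))"

definition hess :: "(real ^ 'n \<Rightarrow> real) \<Rightarrow> real ^ 'n \<Rightarrow> real ^ 'n ^ 'n" where
  "hess f x = matrix (frechet_derivative (grad f) (at x))"

definition twice_cont_diff :: "(real ^ 'n \<Rightarrow> real) \<Rightarrow> bool" where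
  "twice_cont_diff f \<longleftrightarrow>
     (\<forall>x. f differentiable (at x)) \<and> (\<forall>x. grad f differentiable (at x)) \<and>
     continuous_on UNIV (hess f)"

definition pos_def :: "real ^ 'n ^ 'n \<Rightarrow> bool" where
  "pos_def A \<longleftrightarrow> transpose A = A \<and> (\<forall>v. v \<noteq> 0 \<longrightarrow> 0 < (A *v v) \<bullet> v)"

section \<open>The cubic subproblem and its dual\<close>

text \<open>A multiplier vector with entries indexed by 0, ..., m is a function on the naturals of
  which only the values at indices up to m are ever used; likewise for the families F and M.\<close>

definition lu :: "nat \<Rightarrow> (nat \<Rightarrow> real ^ 'n \<Rightarrow> real) \<Rightarrow> real ^ 'n \<Rightarrow> (nat \<Rightarrow> real) \<Rightarrow> real" where
  "lu m F xk u = (\<Sum>i\<le>m. u i * F i xk)"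

definition gu :: "nat \<Rightarrow> (nat \<Rightarrow> real ^ 'n \<Rightarrow> real) \<Rightarrow> real ^ 'n \<Rightarrow> (nat \<Rightarrow> real) \<Rightarrow> real ^ 'n" where
  "gu m F xk u = (\<Sum>i\<le>m. u i *\<^sub>R grad (F i) xk)"

definition Hu :: "nat \<Rightarrow> (nat \<Rightarrow> real ^ 'n \<Rightarrow> real) \<Rightarrow> real ^ 'n \<Rightarrow>
    (nat \<Rightarrow> real) \<Rightarrow> real \<Rightarrow> real ^ 'n ^ 'n" where
  "Hu m F xk u w = (\<Sum>i\<le>m. u i *\<^sub>R hess (F i) xk) + (w / 2) *\<^sub>R mat 1"

definition Mt :: "nat \<Rightarrow> (nat \<Rightarrow> real) \<Rightarrow> (nat \<Rightarrow> real) \<Rightarrow> real" where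
  "Mt m M u = (\<Sum>i\<le>m. u i * M i)"

definition theta :: "nat \<Rightarrow> (nat \<Rightarrow> real ^ 'n \<Rightarrow> real) \<Rightarrow> (nat \<Rightarrow> real) \<Rightarrow> real ^ 'n \<Rightarrow>
    real ^ 'n \<Rightarrow> (nat \<Rightarrow> real) \<Rightarrow> real" where
  "theta m F M xk x u =
     lu m F xk u + gu m F xk u \<bullet> (x - xk)
     + 1/2 * (((\<Sum>i\<le>m. u i *\<^sub>R hess (F i) xk) *v (x - xk)) \<bullet> (x - xk))
     + Mt m M u / 6 * norm (x - xk) ^ 3"

text \<open>The dual function is extended-real valued because the denominator vanishes when the
  aggregated regularization constant is zero. In the extended reals division of a positive
  number by zero is infinite and zero divided by zero is zero, so the dual function is then
  minus infinity for positive w, and the last term disappears for w = 0.\<close>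

definition beta :: "nat \<Rightarrow> (nat \<Rightarrow> real ^ 'n \<Rightarrow> real) \<Rightarrow> (nat \<Rightarrow> real) \<Rightarrow> real ^ 'n \<Rightarrow>
    (nat \<Rightarrow> real) \<Rightarrow> real \<Rightarrow> ereal" where
  "beta m F M xk u w =
     ereal (lu m F xk u
       - 1/2 * ((matrix_inv (Hu m F xk u w) *v gu m F xk u) \<bullet> gu m F xk u))
     - ereal (w ^ 3) / ereal (12 * (Mt m M u)\<^sup>2)"

lemma beta_regular:
  assumes "Mt m M u \<noteq> 0"
  shows "beta m F M xk u w =
    ereal (lu m F xk u
       - 1/2 * ((matrix_inv (Hu m F xk u w) *v gu m F xk u) \<bullet> gu m F xk u)
       - w ^ 3 / (12 * (Mt m M u)\<^sup>2))"
  using assms by (simp add: beta_def)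

lemma beta_degenerate:
  assumes "Mt m M u = 0"
  shows "0 < w \<Longrightarrow> beta m F M xk u w = -\<infinity>"
    and "beta m F M xk u 0 =
      ereal (lu m F xk u
        - 1/2 * ((matrix_inv (Hu m F xk u 0) *v gu m F xk u) \<bullet> gu m F xk u))"
  using assms by (simp_all add: beta_def divide_ereal_def flip: zero_ereal_def)

definition multipliers :: "nat \<Rightarrow> (nat \<Rightarrow> real) set" where
  "multipliers m = {u. (\<forall>i\<le>m. 0 \<le> u i) \<and> u 0 = 1}"

definition dual_dom :: "nat \<Rightarrow> (nat \<Rightarrow> real ^ 'n \<Rightarrow> real) \<Rightarrow> real ^ 'n \<Rightarrow>
    ((nat \<Rightarrow> real) \<times> real) set" where
  "dual_dom m F xk = {(u, w). u \<in> multipliers m \<and> 0 \<le> w \<and> pos_def (Hu m F xk u w)}"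

text \<open>The inner maximum is plus infinity exactly at the points violating a constraint of the
  cubic subproblem, and equals the cubic model of the objective elsewhere.\<close>

definition primal_fun :: "nat \<Rightarrow> (nat \<Rightarrow> real ^ 'n \<Rightarrow> real) \<Rightarrow> (nat \<Rightarrow> real) \<Rightarrow> real ^ 'n \<Rightarrow>
    real ^ 'n \<Rightarrow> ereal" where
  "primal_fun m F M xk x = (SUP u\<in>multipliers m. ereal (theta m F M xk x u))"

definition theta_star :: "nat \<Rightarrow> (nat \<Rightarrow> real ^ 'n \<Rightarrow> real) \<Rightarrow> (nat \<Rightarrow> real) \<Rightarrow> real ^ 'n \<Rightarrow>
    ereal" where
  "theta_star m F M xk = (INF x. primal_fun m F M xk x)"

definition beta_star :: "nat \<Rightarrow> (nat \<Rightarrow> real ^ 'n \<Rightarrow> real) \<Rightarrow> (nat \<Rightarrow> real) \<Rightarrow> real ^ 'n \<Rightarrow>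
    ereal" where
  "beta_star m F M xk = (SUP (u, w)\<in>dual_dom m F xk. beta m F M xk u w)"

definition x_of :: "nat \<Rightarrow> (nat \<Rightarrow> real ^ 'n \<Rightarrow> real) \<Rightarrow> real ^ 'n \<Rightarrow>
    (nat \<Rightarrow> real) \<Rightarrow> real \<Rightarrow> real ^ 'n" where
  "x_of m F xk u w = xk - matrix_inv (Hu m F xk u w) *v gu m F xk u"

end

theory Submission
  imports Defs
begin

text \<open>
  For \<open>(u, w)\<close> in the dual domain, completing the square shows that \<open>x(u, w)\<close> minimizes the
  quadratic with Hessian \<open>H(u, w)\<close>, and the difference between the model and the dual value is a
  cubic in \<open>r\<close> and \<open>w\<close> with the double root \<open>r = w / Mt(u)\<close>. This gives the gap formula and weak
  duality. At a maximizer of the dual, varying \<open>w\<close> alone forces \<open>w = r Mt(u)\<close>. Keeping this ratio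
  \<open>r\<close> fixed while moving \<open>u\<close> towards another multiplier \<open>u'\<close>, the one-sided derivative of the dual
  function is \<open>\<theta>(x, u') - \<theta>(x, u)\<close>, which is therefore nonpositive. So \<open>u\<close> attains the inner maximum
  at \<open>x = x(u, w)\<close>, and there is no gap. The primal minimum exists because the sublevel sets are
  intersections of closed sets, one of which is bounded by the cubic term. Feasibility of the
  perturbed points needs symmetric Hessians, that is, Schwarz's theorem.
\<close>

section \<open>Symmetry of the Hessian\<close>

lemma frechet_derivative_eq_grad:
  fixes f :: "real ^ 'n \<Rightarrow> real"
  assumes "f differentiable (at x)"
  shows "frechet_derivative f (at x) v = grad f x \<bullet> v"
proof -
  interpret linear "frechet_derivative f (at x)"
    by (rule linear_frechet_derivative[OF assms])
  have "frechet_derivative f (at x) v = frechet_derivative f (at x) (\<Sum>j\<in>UNIV. v $ j *\<^sub>R axis j 1)"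
    by (simp add: basis_expansion flip: scalar_mult_eq_scaleR)
  also have "\<dots> = (\<Sum>j\<in>UNIV. v $ j * frechet_derivative f (at x) (axis j 1))"
    by (simp add: sum scale)
  also have "\<dots> = grad f x \<bullet> v"
    by (simp add: grad_def inner_vec_def mult.commute)
  finally show ?thesis .
qed

lemma has_derivative_grad:
  fixes f :: "real ^ 'n \<Rightarrow> real"
  assumes "f differentiable (at x)"
  shows "(f has_derivative (\<lambda>v. grad f x \<bullet> v)) (at x)"
  using assms frechet_derivative_works frechet_derivative_eq_grad[OF assms]
  by (metis (no_types, lifting) ext)

text \<open>Mean value theorem for \<open>p \<mapsto> f (x + b + p *\<^sub>R a) - f (x + p *\<^sub>R
  a)\<close> on [0, 1]. The left side is symmetric in \<open>a\<close> and \<open>b\<close>, the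
  right side is not.\<close>

lemma second_difference_grad:
  fixes f :: "real ^ 'n \<Rightarrow> real"
  assumes "\<And>y. f differentiable (at y)"
  obtains \<xi> where "0 \<le> \<xi>" "\<xi> \<le> 1"
    "f (x + a + b) - f (x + a) - f (x + b) + f x
      = (grad f (x + (\<xi> *\<^sub>R a + b)) - grad f (x + \<xi> *\<^sub>R a)) \<bullet> a"
proof -
  have d: "((\<lambda>p. f (y + p *\<^sub>R a)) has_derivative (\<lambda>s. grad f (y + p *\<^sub>R a) \<bullet> (s *\<^sub>R a))) (at p within S)"
    for y p S
    by (rule has_derivative_compose[OF _ has_derivative_grad[OF assms]])
       (auto intro!: derivative_eq_intros)
  have "\<exists>\<xi>\<in>{0..1}. (f (x + b + 1 *\<^sub>R a) - f (x + 1 *\<^sub>R a)) - (f (x + b + 0 *\<^sub>R a) - f (x + 0 *\<^sub>R a))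
      = grad f (x + b + \<xi> *\<^sub>R a) \<bullet> ((1 - 0) *\<^sub>R a) - grad f (x + \<xi> *\<^sub>R a) \<bullet> ((1 - 0) *\<^sub>R a)"
    by (rule mvt_very_simple[where f = "\<lambda>p. f (x + b + p *\<^sub>R a) - f (x + p *\<^sub>R a)"])
       (auto intro!: has_derivative_diff d simp del: inner_scaleR_right)
  then show ?thesis
    using that by (force simp: algebra_simps)
qed

text \<open>A second difference with steps \<open>s *\<^sub>R a\<close> and
  \<open>s *\<^sub>R b\<close> equals both s^2 (D b . a) and s^2 (D a . b) up to o(s^2).
  Differentiability of the gradient at the single point \<open>x\<close> supplies these
  estimates.\<close>

lemma frechet_derivative_grad_symmetric:
  fixes f :: "real ^ 'n \<Rightarrow> real"
  assumes f: "\<And>y. f differentiable (at y)" and g: "grad f differentiable (at x)"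
  shows "frechet_derivative (grad f) (at x) a \<bullet> b = frechet_derivative (grad f) (at x) b \<bullet> a"
proof -
  define D where "D = frechet_derivative (grad f) (at x)"
  have D: "(grad f has_derivative D) (at x)"
    using g frechet_derivative_works D_def by blast
  interpret D: bounded_linear D
    using D by (rule has_derivative_bounded_linear)
  define N where "N = norm a + norm b + 1"
  have N: "N > 0" by (simp add: N_def add_nonneg_pos)
  have estimate: "\<bar>D a \<bullet> b - D b \<bullet> a\<bar> \<le> 4 * (e * N\<^sup>2)" if e: "e > 0" for e
  proof -
    obtain d where d: "d > 0"
      and rem: "\<And>y. norm (y - x) < d \<Longrightarrow> norm (grad f y - grad f x - D (y - x)) \<le> e * norm (y - x)"
      using D e unfolding has_derivative_at_alt by blast
    \<comment> \<open>Chosen so that s N = d / 2: every point x + s v with |v| at most N lies in the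
      ball where \<open>rem\<close> applies.\<close>
    define s where "s = d / (2 * N)"
    have s: "s > 0" "s * N < d" using d N by (auto simp: s_def)
    define \<Delta> where "\<Delta> = f (x + s *\<^sub>R a + s *\<^sub>R b) - f (x + s *\<^sub>R a) - f (x + s *\<^sub>R b) + f x"
    have rem': "norm (grad f (x + s *\<^sub>R v) - grad f x - s *\<^sub>R D v) \<le> e * (s * N)"
      if "norm v \<le> N" for v
    proof -
      have "norm (s *\<^sub>R v) \<le> s * N" using that s by simp
      then have "norm (grad f (x + s *\<^sub>R v) - grad f x - D (s *\<^sub>R v)) \<le> e * norm (s *\<^sub>R v)"
        using rem[of "x + s *\<^sub>R v"] order.strict_trans1[OF _ s(2)] by (simp del: norm_scaleR)
      also have "\<dots> \<le> e * (s * N)" using e \<open>norm (s *\<^sub>R v) \<le> s * N\<close> by (intro mult_left_mono) auto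
      finally show ?thesis by (simp add: D.scaleR)
    qed
    \<comment> \<open>Stated for general \<open>p\<close>, \<open>q\<close> so that it can be used
      in both orders on the same \<open>\<Delta>\<close>.\<close>
    have half: "\<bar>(f (x + s *\<^sub>R p + s *\<^sub>R q) - f (x + s *\<^sub>R p) - f (x + s *\<^sub>R q) + f x) - s\<^sup>2 * (D q \<bullet> p)\<bar>
        \<le> 2 * e * s\<^sup>2 * N\<^sup>2"
      if pq: "norm p + norm q \<le> N" for p q
    proof -
      obtain \<xi> where \<xi>: "0 \<le> \<xi>" "\<xi> \<le> 1"
        and eq: "f (x + s *\<^sub>R p + s *\<^sub>R q) - f (x + s *\<^sub>R p) - f (x + s *\<^sub>R q) + f x
          = (grad f (x + (\<xi> *\<^sub>R s *\<^sub>R p + s *\<^sub>R q)) - grad f (x + \<xi> *\<^sub>R s *\<^sub>R p)) \<bullet> (s *\<^sub>R p)"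
        using second_difference_grad[OF f] by blast
      have xp: "norm (\<xi> *\<^sub>R p) \<le> norm p" using \<xi> by (simp add: mult_left_le_one_le)
      have n2: "norm (\<xi> *\<^sub>R p) \<le> N" using xp pq norm_ge_zero[of q] by linarith
      have n1: "norm (\<xi> *\<^sub>R p + q) \<le> N" using xp pq norm_triangle_ineq[of "\<xi> *\<^sub>R p" q] by linarith
      define r1 where "r1 = grad f (x + s *\<^sub>R (\<xi> *\<^sub>R p + q)) - grad f x - s *\<^sub>R D (\<xi> *\<^sub>R p + q)"
      define r2 where "r2 = grad f (x + s *\<^sub>R (\<xi> *\<^sub>R p)) - grad f x - s *\<^sub>R D (\<xi> *\<^sub>R p)"
      \<comment> \<open>By linearity D (\<xi> p + q) - D (\<xi> p) = D q, so the unknown \<xi>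
        survives only in the remainders.\<close>
      have "(grad f (x + (\<xi> *\<^sub>R s *\<^sub>R p + s *\<^sub>R q)) - grad f (x + \<xi> *\<^sub>R s *\<^sub>R p)) \<bullet> (s *\<^sub>R p) - s\<^sup>2 * (D q \<bullet> p)
          = s * ((r1 - r2) \<bullet> p)"
        by (simp add: r1_def r2_def D.add D.scaleR scaleR_add_right inner_simps power2_eq_square
            mult.commute algebra_simps)
      also have "\<bar>\<dots>\<bar> \<le> s * ((norm r1 + norm r2) * norm p)"
        using s order_trans[OF Cauchy_Schwarz_ineq2[of "r1 - r2" p]
            mult_right_mono[OF norm_triangle_ineq4[of r1 r2] norm_ge_zero[of p]]]
        by (simp add: abs_mult)
      also have "\<dots> \<le> s * ((e * (s * N) + e * (s * N)) * N)"
      proof -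
        have "norm p \<le> N" using pq norm_ge_zero[of q] by linarith
        then show ?thesis
          using rem'[OF n1] rem'[OF n2] s e N
          by (intro mult_left_mono mult_mono add_mono) (auto simp: r1_def r2_def)
      qed
      also have "\<dots> = 2 * e * s\<^sup>2 * N\<^sup>2" by (simp add: power2_eq_square algebra_simps)
      finally show ?thesis unfolding eq .
    qed
    have "\<bar>\<Delta> - s\<^sup>2 * (D b \<bullet> a)\<bar> \<le> 2 * e * s\<^sup>2 * N\<^sup>2"
      using half[of a b] by (simp add: \<Delta>_def N_def)
    moreover have "\<bar>\<Delta> - s\<^sup>2 * (D a \<bullet> b)\<bar> \<le> 2 * e * s\<^sup>2 * N\<^sup>2"
      using half[of b a] by (simp add: \<Delta>_def N_def algebra_simps)
    ultimately have "\<bar>s\<^sup>2 * (D a \<bullet> b) - s\<^sup>2 * (D b \<bullet> a)\<bar> \<le> s\<^sup>2 * (4 * (e * N\<^sup>2))"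
      by (simp add: algebra_simps)
    then have "s\<^sup>2 * \<bar>D a \<bullet> b - D b \<bullet> a\<bar> \<le> s\<^sup>2 * (4 * (e * N\<^sup>2))"
      by (simp add: abs_mult flip: right_diff_distrib)
    then show ?thesis using s by simp
  qed
  have "\<bar>D a \<bullet> b - D b \<bullet> a\<bar> \<le> 0"
  proof (rule field_le_epsilon)
    fix e :: real assume "e > 0"
    then show "\<bar>D a \<bullet> b - D b \<bullet> a\<bar> \<le> 0 + e"
      using estimate[of "e / (4 * N\<^sup>2)"] N by (simp add: field_simps)
  qed
  then show ?thesis by (simp add: D_def)
qed

lemma transpose_hess:
  assumes "twice_cont_diff f"
  shows "transpose (hess f x) = hess f x"
proof -
  have "frechet_derivative (grad f) (at x) (axis i 1) $ j = frechet_derivative (grad f) (at x) (axis j 1) $ i"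
    for i j
    using frechet_derivative_grad_symmetric[of f x "axis i 1" "axis j 1"] assms
    by (simp add: twice_cont_diff_def inner_axis)
  then show ?thesis
    by (simp add: vec_eq_iff transpose_def hess_def matrix_def)
qed

section \<open>Positive definite quadratics and their perturbation\<close>

lemma symmetric_matrix_inner:
  fixes A :: "real ^ 'n ^ 'n"
  assumes "transpose A = A"
  shows "(A *v x) \<bullet> y = (A *v y) \<bullet> x"
  by (metis assms dot_lmul_matrix inner_commute transpose_matrix_vector)

lemma quadratic_form_bounded:
  fixes B :: "real ^ 'n ^ 'n"
  obtains K where "K \<ge> 0" "\<And>v. \<bar>(B *v v) \<bullet> v\<bar> \<le> K * (norm v)\<^sup>2"
proof -
  obtain K where K: "K \<ge> 0" "\<And>v. norm (B *v v) \<le> norm v * K"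
    using bounded_linear.nonneg_bounded[OF matrix_vector_mul_bounded_linear[of B]] by auto
  have "\<bar>(B *v v) \<bullet> v\<bar> \<le> K * (norm v)\<^sup>2" for v
  proof -
    have "\<bar>(B *v v) \<bullet> v\<bar> \<le> norm (B *v v) * norm v" by (rule Cauchy_Schwarz_ineq2)
    also have "\<dots> \<le> norm v * K * norm v" by (intro mult_right_mono K) auto
    finally show ?thesis by (simp add: power2_eq_square mult_ac)
  qed
  with K that show ?thesis by blast
qed

text \<open>The constant is the minimum of the form over the compact unit sphere, positive because
  it is attained; homogeneity extends the bound.\<close>

lemma pos_def_coercive:
  fixes A :: "real ^ 'n ^ 'n"
  assumes "pos_def A"
  obtains k where "k > 0" "\<And>v. k * (norm v)\<^sup>2 \<le> (A *v v) \<bullet> v"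
proof -
  have "\<exists>x\<in>sphere 0 1. \<forall>y\<in>sphere 0 1. (A *v x) \<bullet> x \<le> (A *v y) \<bullet> (y :: real ^ 'n)"
    by (rule continuous_attains_inf)
       (auto intro!: continuous_intros linear_continuous_on[OF matrix_vector_mul_bounded_linear] simp: ex_in_conv[symmetric] intro: exI[of _ "axis i 1" for i])
  then obtain x where x: "norm x = 1" "\<And>y. norm y = 1 \<Longrightarrow> (A *v x) \<bullet> x \<le> (A *v y) \<bullet> y"
    by auto
  have "(A *v x) \<bullet> x * (norm v)\<^sup>2 \<le> (A *v v) \<bullet> v" for v
  proof (cases "v = 0")
    case False
    then show ?thesis
      using x(2)[of "(1 / norm v) *\<^sub>R v"]
      by (simp add: matrix_vector_mult_scaleR field_simps power2_eq_square)
  qed simp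
  moreover have "x \<noteq> 0" using x(1) by auto
  then have "(A *v x) \<bullet> x > 0" using assms by (simp add: pos_def_def)
  ultimately show ?thesis using that by blast
qed

lemma pos_def_solve:
  fixes A :: "real ^ 'n ^ 'n"
  assumes "pos_def A"
  shows "A *v (matrix_inv A *v b) = b"
proof -
  have "\<forall>v. A *v v = 0 \<longrightarrow> v = 0" using assms by (force simp: pos_def_def)
  then have "\<exists>B. A ** B = mat 1 \<and> B ** A = mat 1"
    using matrix_left_invertible_ker[of A] matrix_left_right_inverse by blast
  then have "A ** matrix_inv A = mat 1"
    unfolding matrix_inv_def by (rule someI2_ex) simp
  then show ?thesis
    by (simp add: matrix_vector_mul_assoc)
qed

text \<open>Expand using A (A^-1 b) = b; symmetry of A merges the two cross terms.\<close>

lemma pos_def_complete_square: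
  fixes A :: "real ^ 'n ^ 'n"
  assumes "pos_def A"
  shows "b \<bullet> x + 1/2 * ((A *v x) \<bullet> x) = - 1/2 * ((matrix_inv A *v b) \<bullet> b)
    + 1/2 * ((A *v (x + matrix_inv A *v b)) \<bullet> (x + matrix_inv A *v b))"
proof -
  have s: "transpose A = A" using assms by (simp add: pos_def_def)
  show ?thesis
    using symmetric_matrix_inner[OF s, of x "matrix_inv A *v b"]
    by (simp add: matrix_vector_right_distrib inner_simps pos_def_solve[OF assms] inner_commute algebra_simps)
qed

lemma pos_def_min_le:
  fixes A :: "real ^ 'n ^ 'n"
  assumes "pos_def A"
  shows "- 1/2 * ((matrix_inv A *v b) \<bullet> b) \<le> b \<bullet> x + 1/2 * ((A *v x) \<bullet> x)"
proof -
  have "0 \<le> (A *v v) \<bullet> v" for v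
    using assms by (cases "v = 0") (auto simp: pos_def_def intro: less_imp_le)
  then show ?thesis unfolding pos_def_complete_square[OF assms] by simp
qed

lemma pos_def_min_eq:
  fixes A :: "real ^ 'n ^ 'n"
  assumes "pos_def A"
  shows "b \<bullet> (- (matrix_inv A *v b)) + 1/2 * ((A *v (- (matrix_inv A *v b))) \<bullet> (- (matrix_inv A *v b)))
    = - 1/2 * ((matrix_inv A *v b) \<bullet> b)"
  unfolding pos_def_complete_square[OF assms] by simp

text \<open>The coercivity constant is uniform in \<open>t\<close>, as needed for an error bound
  that is uniform along the perturbation.\<close>

lemma pos_def_perturb:
  fixes A B :: "real ^ 'n ^ 'n"
  assumes A: "pos_def A" and B: "transpose B = B"
  obtains k \<delta> where "k > 0" "\<delta> > 0"
    "\<And>t. 0 \<le> t \<Longrightarrow> t \<le> \<delta> \<Longrightarrow> pos_def (A + t *\<^sub>R B)"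
    "\<And>t v. 0 \<le> t \<Longrightarrow> t \<le> \<delta> \<Longrightarrow> k * (norm v)\<^sup>2 \<le> ((A + t *\<^sub>R B) *v v) \<bullet> v"
proof -
  obtain k where k: "k > 0" "\<And>v. k * (norm v)\<^sup>2 \<le> (A *v v) \<bullet> v"
    using pos_def_coercive[OF A] by blast
  obtain L where L: "L \<ge> 0" "\<And>v. \<bar>(B *v v) \<bullet> v\<bar> \<le> L * (norm v)\<^sup>2"
    using quadratic_form_bounded[of B] by blast
  \<comment> \<open>Makes t L at most k / 2, so half of the coercivity of A survives; the + 1 avoids
    division by zero when L = 0.\<close>
  define \<delta> where "\<delta> = k / (2 * (L + 1))"
  have low: "k / 2 * (norm v)\<^sup>2 \<le> ((A + t *\<^sub>R B) *v v) \<bullet> v" if t: "0 \<le> t" "t \<le> \<delta>" for t v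
  proof -
    have "t * L \<le> k / 2"
    proof -
      have "t * L \<le> \<delta> * (L + 1)" using t L by (intro mult_mono) auto
      also have "\<dots> = k / 2" using L by (simp add: \<delta>_def field_simps)
      finally show ?thesis .
    qed
    then have "t * (L * (norm v)\<^sup>2) \<le> k / 2 * (norm v)\<^sup>2"
      using mult_right_mono[of "t * L" "k / 2" "(norm v)\<^sup>2"] by (simp add: mult.assoc)
    moreover have "- (t * (L * (norm v)\<^sup>2)) \<le> t * ((B *v v) \<bullet> v)"
      using t mult_left_mono[of "- (L * (norm v)\<^sup>2)" "(B *v v) \<bullet> v" t] L(2)[of v] by (simp add: abs_le_iff)
    moreover have "((A + t *\<^sub>R B) *v v) \<bullet> v = (A *v v) \<bullet> v + t * ((B *v v) \<bullet> v)"
      by (simp add: matrix_vector_mult_add_rdistrib inner_simps flip: scaleR_matrix_vector_assoc)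
    ultimately show ?thesis using k(2)[of v] by simp
  qed
  have pd: "pos_def (A + t *\<^sub>R B)" if t: "0 \<le> t" "t \<le> \<delta>" for t
  proof -
    have "transpose (A + t *\<^sub>R B) = A + t *\<^sub>R B"
      using A B by (simp add: pos_def_def transpose_def vec_eq_iff)
    moreover have "0 < ((A + t *\<^sub>R B) *v v) \<bullet> v" if "v \<noteq> 0" for v
    proof -
      have "0 < k / 2 * (norm v)\<^sup>2" using k that by simp
      then show ?thesis using low[OF t, of v] by linarith
    qed
    ultimately show ?thesis by (simp add: pos_def_def)
  qed
  show ?thesis
  proof (rule that)
    show "k / 2 > 0" "\<delta> > 0" using k L by (simp_all add: \<delta>_def)
  qed (use pd low in auto)
qed

text \<open>The minimum value of a strictly convex quadratic has the one-sided derivative predicted by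
  the envelope theorem, with a quadratic error; this avoids differentiating the matrix inverse.\<close>

lemma quadratic_min_perturb:
  fixes A B :: "real ^ 'n ^ 'n" and b c :: "real ^ 'n"
  assumes A: "pos_def A" and B: "transpose B = B"
  defines "h \<equiv> - (matrix_inv A *v b)"
  obtains K \<delta> where "\<delta> > 0"
    "\<And>t. 0 \<le> t \<Longrightarrow> t \<le> \<delta> \<Longrightarrow> pos_def (A + t *\<^sub>R B)"
    "\<And>t. 0 \<le> t \<Longrightarrow> t \<le> \<delta> \<Longrightarrow>
      - 1/2 * ((matrix_inv A *v b) \<bullet> b) + t * (c \<bullet> h + 1/2 * ((B *v h) \<bullet> h)) - K * t\<^sup>2
      \<le> - 1/2 * ((matrix_inv (A + t *\<^sub>R B) *v (b + t *\<^sub>R c)) \<bullet> (b + t *\<^sub>R c))"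
proof -
  obtain k \<delta> where k: "k > 0" and \<delta>: "\<delta> > 0"
    and pd: "\<And>t. 0 \<le> t \<Longrightarrow> t \<le> \<delta> \<Longrightarrow> pos_def (A + t *\<^sub>R B)"
    and low: "\<And>t v. 0 \<le> t \<Longrightarrow> t \<le> \<delta> \<Longrightarrow> k * (norm v)\<^sup>2 \<le> ((A + t *\<^sub>R B) *v v) \<bullet> v"
    by (rule pos_def_perturb[OF A B]) (rule that)
  \<comment> \<open>With G = |c + B h|, the minimum over real y of - t G y + (k/2) y^2 is - t^2 G^2
    / (2 k), that is, - K t^2.\<close>
  define K where "K = (norm (c + B *v h))\<^sup>2 / (2 * k)"
  show ?thesis
  proof (rule that)
    show "\<delta> > 0" by (rule \<delta>)
    show "pos_def (A + t *\<^sub>R B)" if "0 \<le> t" "t \<le> \<delta>" for t using pd that .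
    show "- 1/2 * ((matrix_inv A *v b) \<bullet> b) + t * (c \<bullet> h + 1/2 * ((B *v h) \<bullet> h)) - K * t\<^sup>2
      \<le> - 1/2 * ((matrix_inv (A + t *\<^sub>R B) *v (b + t *\<^sub>R c)) \<bullet> (b + t *\<^sub>R c))"
      if t: "0 \<le> t" "t \<le> \<delta>" for t
    proof -
      define x where "x = - (matrix_inv (A + t *\<^sub>R B) *v (b + t *\<^sub>R c))"
      \<comment> \<open>Displacement of the perturbed minimizer. Its size is never estimated:
        coercivity absorbs the term linear in \<open>v\<close>.\<close>
      define v where "v = x - h"
      have x: "x = h + v" by (simp add: v_def)
      have "(b + t *\<^sub>R c) \<bullet> x + 1/2 * (((A + t *\<^sub>R B) *v x) \<bullet> x)
        = (b \<bullet> x + 1/2 * ((A *v x) \<bullet> x)) + t * (c \<bullet> x + 1/2 * ((B *v x) \<bullet> x))"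
        by (simp add: matrix_vector_mult_add_rdistrib inner_simps algebra_simps flip: scaleR_matrix_vector_assoc)
      also have "b \<bullet> x + 1/2 * ((A *v x) \<bullet> x) = - 1/2 * ((matrix_inv A *v b) \<bullet> b) + 1/2 * ((A *v v) \<bullet> v)"
        unfolding pos_def_complete_square[OF A] by (simp add: v_def h_def)
      also have "c \<bullet> x + 1/2 * ((B *v x) \<bullet> x)
        = (c \<bullet> h + 1/2 * ((B *v h) \<bullet> h)) + (c + B *v h) \<bullet> v + 1/2 * ((B *v v) \<bullet> v)"
        using symmetric_matrix_inner[OF B, of v h]
        by (simp add: x matrix_vector_right_distrib inner_simps algebra_simps)
      finally have "- 1/2 * ((matrix_inv (A + t *\<^sub>R B) *v (b + t *\<^sub>R c)) \<bullet> (b + t *\<^sub>R c))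
        = - 1/2 * ((matrix_inv A *v b) \<bullet> b) + t * (c \<bullet> h + 1/2 * ((B *v h) \<bullet> h))
          + t * ((c + B *v h) \<bullet> v) + 1/2 * (((A + t *\<^sub>R B) *v v) \<bullet> v)"
        using pos_def_min_eq[OF pd[OF t], of "b + t *\<^sub>R c"]
        by (simp add: x_def matrix_vector_mult_add_rdistrib inner_simps algebra_simps flip: scaleR_matrix_vector_assoc)
      moreover have "- (t * (norm (c + B *v h) * norm v)) \<le> t * ((c + B *v h) \<bullet> v)"
        using mult_left_mono[OF _ t(1), of "- (norm (c + B *v h) * norm v)"]
          Cauchy_Schwarz_ineq2[of "c + B *v h" v] by (simp add: abs_le_iff)
      moreover have "- (K * t\<^sup>2) \<le> - (t * (norm (c + B *v h) * norm v)) + k / 2 * (norm v)\<^sup>2"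
      proof -
        have "0 \<le> (2 * t * norm (c + B *v h) - 2 * k * norm v)\<^sup>2 / (8 * k)" using k by simp
        also have "\<dots> = K * t\<^sup>2 - t * (norm (c + B *v h) * norm v) + k / 2 * (norm v)\<^sup>2"
          using k by (simp add: K_def field_simps power2_eq_square)
        finally show ?thesis by simp
      qed
      ultimately show ?thesis using low[OF t, of v] by simp
    qed
  qed
qed

section \<open>The model and its dual function\<close>

text \<open>All data are linear in the multiplier. The direction \<open>d\<close> is arbitrary,
  since differences of multipliers may have negative entries.\<close>

lemma lu_add_scaled: "lu m F xk (\<lambda>i. u i + t * d i) = lu m F xk u + t * lu m F xk d"
  by (simp add: lu_def algebra_simps sum.distrib sum_distrib_left)

lemma gu_add_scaled: "gu m F xk (\<lambda>i. u i + t * d i) = gu m F xk u + t *\<^sub>R gu m F xk d"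
  by (simp add: gu_def algebra_simps sum.distrib scaleR_sum_right)

lemma Hu_add_scaled:
  "Hu m F xk (\<lambda>i. u i + t * d i) (w + t * v) = Hu m F xk u w + t *\<^sub>R Hu m F xk d v"
  by (simp add: Hu_def algebra_simps sum.distrib scaleR_sum_right add_divide_distrib)

lemma Mt_add_scaled: "Mt m M (\<lambda>i. u i + t * d i) = Mt m M u + t * Mt m M d"
  by (simp add: Mt_def algebra_simps sum.distrib sum_distrib_left)

lemma Mt_nonneg:
  assumes "\<And>i. i \<le> m \<Longrightarrow> 0 \<le> M i" "u \<in> multipliers m"
  shows "0 \<le> Mt m M u"
  using assms by (auto simp: Mt_def multipliers_def intro!: sum_nonneg)

text \<open>Adding and subtracting (w/4) |x - xk|^2 trades the possibly indefinite Hessian for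
  \<open>Hu\<close>. The left side is independent of \<open>w\<close>, which may thus be chosen
  freely in each application.\<close>

lemma theta_eq_Hu:
  "theta m F M xk x u = lu m F xk u
    + (gu m F xk u \<bullet> (x - xk) + 1/2 * ((Hu m F xk u w *v (x - xk)) \<bullet> (x - xk)))
    - w / 4 * (norm (x - xk))\<^sup>2 + Mt m M u / 6 * norm (x - xk) ^ 3"
proof -
  have "(Hu m F xk u w *v h) \<bullet> h = ((\<Sum>i\<le>m. u i *\<^sub>R hess (F i) xk) *v h) \<bullet> h + w / 2 * (norm h)\<^sup>2" for h
    by (simp add: Hu_def matrix_vector_mult_add_rdistrib inner_simps
        dot_square_norm flip: scaleR_matrix_vector_assoc)
  note H = this[of "x - xk"]
  define h where "h = x - xk"
  show ?thesis
    unfolding theta_def H unfolding h_def[symmetric] by (simp add: algebra_simps)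
qed

lemma theta_add_scaled:
  "theta m F M xk x (\<lambda>i. u i + t * d i) = theta m F M xk x u + t * theta m F M xk x d"
proof -
  have H: "Hu m F xk (\<lambda>i. u i + t * d i) 0 = Hu m F xk u 0 + t *\<^sub>R Hu m F xk d 0"
    using Hu_add_scaled[of m F xk u t d 0 0] by simp
  show ?thesis
    unfolding theta_eq_Hu[where w = 0] H gu_add_scaled lu_add_scaled Mt_add_scaled
    by (simp add: matrix_vector_mult_add_rdistrib inner_simps algebra_simps flip: scaleR_matrix_vector_assoc)
qed

lemma multipliers_convex:
  assumes "u \<in> multipliers m" "u' \<in> multipliers m" "0 \<le> t" "t \<le> 1"
  shows "(\<lambda>i. u i + t * (u' i - u i)) \<in> multipliers m"
proof -
  have "u i + t * (u' i - u i) = (1 - t) * u i + t * u' i" for i by (simp add: algebra_simps)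
  with assms show ?thesis by (simp add: multipliers_def)
qed

lemma transpose_Hu:
  assumes "\<And>i. i \<le> m \<Longrightarrow> twice_cont_diff (F i)"
  shows "transpose (Hu m F xk u w) = Hu m F xk u w"
proof -
  have "hess (F i) xk $ k $ j = hess (F i) xk $ j $ k" if "i \<le> m" for i j k
    using transpose_hess[OF assms[OF that], of xk] by (simp add: transpose_def vec_eq_iff)
  then show ?thesis
    by (auto simp: Hu_def transpose_def vec_eq_iff mat_def intro!: sum.cong)
qed

section \<open>The cubic gap and the pointwise dual bound\<close>

text \<open>With \<rho> = w / \<mu> this is 2 r^3 - 3 \<rho> r^2 + \<rho>^3 = (\<rho> + 2 r) (r -
  \<rho>)^2, scaled by \<mu> / 12.\<close>

lemma cubic_gap:
  fixes \<mu> r w :: real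
  assumes "\<mu> \<noteq> 0"
  shows "\<mu> / 6 * r ^ 3 - w / 4 * r\<^sup>2 + w ^ 3 / (12 * \<mu>\<^sup>2) = \<mu> / 12 * (w / \<mu> + 2 * r) * (r - w / \<mu>)\<^sup>2"
  using assms by (simp add: field_simps power2_eq_square power3_eq_cube)

lemma cubic_gap_nonneg:
  fixes \<mu> r w :: real
  assumes "\<mu> > 0" "w \<ge> 0" "r \<ge> 0"
  shows "0 \<le> \<mu> / 6 * r ^ 3 - w / 4 * r\<^sup>2 + w ^ 3 / (12 * \<mu>\<^sup>2)"
  using assms by (subst cubic_gap) auto

lemma beta_le_theta:
  assumes M: "\<And>i. i \<le> m \<Longrightarrow> 0 \<le> M i" and D: "(u, w) \<in> dual_dom m F xk"
  shows "beta m F M xk u w \<le> ereal (theta m F M xk x u)"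
proof -
  have u: "u \<in> multipliers m" and w: "w \<ge> 0" and pd: "pos_def (Hu m F xk u w)"
    using D by (auto simp: dual_dom_def)
  note min = pos_def_min_le[OF pd, of "gu m F xk u" "x - xk"]
  \<comment> \<open>When \<open>Mt\<close> vanishes, \<open>beta\<close> is minus infinity for w >
    0, and for w = 0 both cubic terms disappear.\<close>
  consider "Mt m M u > 0" | "Mt m M u = 0" "w > 0" | "Mt m M u = 0" "w = 0"
    using Mt_nonneg[where M = M, OF M u] w by linarith
  then show ?thesis
  proof cases
    case 1
    then show ?thesis
      using min cubic_gap_nonneg[OF 1 w norm_ge_zero[of "x - xk"]]
      by (simp add: beta_regular theta_eq_Hu[where w = w])
  next
    case 2
    then show ?thesis by (simp add: beta_degenerate)
  next
    case 3
    then show ?thesis using min by (simp add: beta_degenerate theta_eq_Hu[where w = 0])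
  qed
qed

text \<open>With the substitution \<open>w = \<rho> Mt(u)\<close> the last term of the dual function becomes linear
  in the multipliers, and the degenerate case is covered as well.\<close>

lemma beta_proportional:
  "beta m F M xk u (\<rho> * Mt m M u) = ereal (lu m F xk u
    - 1/2 * ((matrix_inv (Hu m F xk u (\<rho> * Mt m M u)) *v gu m F xk u) \<bullet> gu m F xk u)
    - \<rho> ^ 3 * Mt m M u / 12)"
proof (cases "Mt m M u = 0")
  case True
  then show ?thesis by (simp add: beta_degenerate(2))
next
  case False
  then have "(\<rho> * Mt m M u) ^ 3 / (12 * (Mt m M u)\<^sup>2) = \<rho> ^ 3 * Mt m M u / 12"
    by (simp add: field_simps power2_eq_square power3_eq_cube)
  with False show ?thesis by (simp add: beta_regular)
qed

lemma x_of_minus: "x_of m F xk u w - xk = - (matrix_inv (Hu m F xk u w) *v gu m F xk u)"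
  by (simp add: x_of_def)

lemma theta_x_of:
  assumes "pos_def (Hu m F xk u w)"
  shows "theta m F M xk (x_of m F xk u w) u = lu m F xk u
    - 1/2 * ((matrix_inv (Hu m F xk u w) *v gu m F xk u) \<bullet> gu m F xk u)
    - w / 4 * (norm (x_of m F xk u w - xk))\<^sup>2 + Mt m M u / 6 * norm (x_of m F xk u w - xk) ^ 3"
  unfolding theta_eq_Hu[where w = w] x_of_minus
  by (simp only: pos_def_min_eq[OF assms])

lemma duality_gap:
  assumes "pos_def (Hu m F xk u w)" and "Mt m M u \<noteq> 0"
  shows "ereal (theta m F M xk (x_of m F xk u w) u) - beta m F M xk u w
    = ereal (Mt m M u / 12 * (w / Mt m M u + 2 * norm (x_of m F xk u w - xk))
        * (norm (x_of m F xk u w - xk) - w / Mt m M u)\<^sup>2)"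
  unfolding cubic_gap[OF assms(2), symmetric] using assms
  by (simp add: beta_regular theta_x_of)

section \<open>Optimality conditions at a dual maximizer\<close>

text \<open>First-order condition without limits: \<open>a\<close> is a one-sided derivative at a
  maximizer, \<open>K\<close> bounds the second-order error.\<close>

lemma nonpos_of_quadratic_bound:
  fixes a K \<delta> :: real
  assumes "\<delta> > 0" and le: "\<And>t. 0 < t \<Longrightarrow> t \<le> \<delta> \<Longrightarrow> t * a \<le> K * t\<^sup>2"
  shows "a \<le> 0"
proof (rule ccontr)
  assume "\<not> a \<le> 0"
  define t where "t = min \<delta> (a / (2 * (\<bar>K\<bar> + 1)))"
  have t: "t > 0" "t \<le> \<delta>" using assms(1) \<open>\<not> a \<le> 0\<close> by (auto simp: t_def)
  have "t * a \<le> t * (K * t)" using le[OF t] by (simp add: power2_eq_square mult_ac)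
  then have "a \<le> K * t" using t by simp
  also have "\<dots> \<le> (\<bar>K\<bar> + 1) * (a / (2 * (\<bar>K\<bar> + 1)))"
    using t by (intro mult_mono) (auto simp: t_def)
  also have "\<dots> = a / 2" by (simp add: field_simps)
  finally show False using \<open>\<not> a \<le> 0\<close> by simp
qed

text \<open>Here s = 1 or s = -1 is the direction in which \<open>w\<close> moves with
  \<open>u\<close> fixed. The directional derivative of the dual function is (s/4) (|h|^2 - (w /
  \<mu>)^2), with h = x(u, w) - xk; \<open>e\<close> keeps w + t s nonnegative.\<close>

lemma dual_max_w_direction:
  fixes F :: "nat \<Rightarrow> real ^ 'n \<Rightarrow> real"
  assumes D: "(u, w) \<in> dual_dom m F xk" and Mt: "Mt m M u > 0"
    and max: "\<And>u' w'. (u', w') \<in> dual_dom m F xk \<Longrightarrow> beta m F M xk u' w' \<le> beta m F M xk u w"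
    and s: "s\<^sup>2 = 1" and e: "e > 0" "\<And>t. 0 \<le> t \<Longrightarrow> t \<le> e \<Longrightarrow> 0 \<le> w + t * s"
  shows "s * ((norm (x_of m F xk u w - xk))\<^sup>2 - (w / Mt m M u)\<^sup>2) \<le> 0"
proof -
  define A where "A = Hu m F xk u w"
  define b where "b = gu m F xk u"
  define h where "h = - (matrix_inv A *v b)"
  define \<mu> where "\<mu> = Mt m M u"
  have u: "u \<in> multipliers m" and w: "w \<ge> 0" and pd: "pos_def A"
    using D by (auto simp: dual_dom_def A_def)
  have tr: "transpose ((s / 2) *\<^sub>R mat 1 :: real ^ 'n ^ 'n) = (s / 2) *\<^sub>R mat 1"
    by (auto simp: transpose_def vec_eq_iff mat_def)
  obtain K \<delta> where \<delta>: "\<delta> > 0"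
    and pdt: "\<And>t. 0 \<le> t \<Longrightarrow> t \<le> \<delta> \<Longrightarrow> pos_def (A + t *\<^sub>R ((s / 2) *\<^sub>R mat 1))"
    and Vt: "\<And>t. 0 \<le> t \<Longrightarrow> t \<le> \<delta> \<Longrightarrow>
      - 1/2 * ((matrix_inv A *v b) \<bullet> b) + t * (0 \<bullet> h + 1/2 * ((((s / 2) *\<^sub>R mat 1) *v h) \<bullet> h)) - K * t\<^sup>2
      \<le> - 1/2 * ((matrix_inv (A + t *\<^sub>R ((s / 2) *\<^sub>R mat 1)) *v (b + t *\<^sub>R 0)) \<bullet> (b + t *\<^sub>R 0))"
    by (rule quadratic_min_perturb[OF pd tr, where b = b and c = 0, folded h_def]) (rule that)
  have nh: "x_of m F xk u w - xk = h" by (simp add: x_of_minus h_def A_def b_def)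
  have Ht: "Hu m F xk u (w + t * s) = A + t *\<^sub>R ((s / 2) *\<^sub>R mat 1)" for t
    by (simp add: A_def Hu_def algebra_simps add_divide_distrib)
  have "s * (norm h)\<^sup>2 / 4 - s * w\<^sup>2 / (4 * \<mu>\<^sup>2) \<le> 0"
  proof (rule nonpos_of_quadratic_bound)
    show "min 1 (min \<delta> e) > 0" using \<delta> e by simp
    fix t :: real assume t: "0 < t" "t \<le> min 1 (min \<delta> e)"
    have "(u, w + t * s) \<in> dual_dom m F xk"
      using t u e pdt[of t] by (simp add: dual_dom_def Ht)
    from max[OF this] have le: "- 1/2 * ((matrix_inv (A + t *\<^sub>R ((s / 2) *\<^sub>R mat 1)) *v b) \<bullet> b)
        - (w + t * s) ^ 3 / (12 * \<mu>\<^sup>2)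
      \<le> - 1/2 * ((matrix_inv A *v b) \<bullet> b) - w ^ 3 / (12 * \<mu>\<^sup>2)"
      using Mt by (simp add: beta_regular Ht b_def \<mu>_def flip: A_def)
    have lo: "- 1/2 * ((matrix_inv A *v b) \<bullet> b) + t * (s * (norm h)\<^sup>2 / 4) - K * t\<^sup>2
      \<le> - 1/2 * ((matrix_inv (A + t *\<^sub>R ((s / 2) *\<^sub>R mat 1)) *v b) \<bullet> b)"
      using Vt[of t] t by (simp add: dot_square_norm flip: scaleR_matrix_vector_assoc)
    \<comment> \<open>Only the term linear in \<open>t\<close> must be exact; s^2 = 1 and t \<le> 1
      turn the rest into a multiple of t^2.\<close>
    have "(w + t * s) ^ 3 - w ^ 3 = 3 * w\<^sup>2 * t * s + 3 * w * t\<^sup>2 * s\<^sup>2 + t * (t\<^sup>2 * s) * s\<^sup>2"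
      by (simp add: power2_eq_square power3_eq_cube algebra_simps)
    also have "\<dots> \<le> 3 * w\<^sup>2 * t * s + (3 * w + 1) * t\<^sup>2"
    proof -
      have "s \<le> 1" using s by (auto simp: power2_eq_1_iff)
      then have "t * s \<le> t * 1" using t by (intro mult_left_mono) auto
      with t have "t * s \<le> 1" by linarith
      then have "t * (t\<^sup>2 * s) \<le> t\<^sup>2"
        using mult_right_mono[of "t * s" 1 "t\<^sup>2"] by (simp add: mult_ac)
      then show ?thesis using s by (simp add: algebra_simps)
    qed
    finally have "((w + t * s) ^ 3 - w ^ 3) / (12 * \<mu>\<^sup>2) \<le> (3 * w\<^sup>2 * t * s + (3 * w + 1) * t\<^sup>2) / (12 * \<mu>\<^sup>2)"
      by (rule divide_right_mono) simp
    also have "\<dots> = t * (s * w\<^sup>2 / (4 * \<mu>\<^sup>2)) + (3 * w + 1) / (12 * \<mu>\<^sup>2) * t\<^sup>2"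
      using Mt by (simp add: \<mu>_def field_simps)
    finally show "t * (s * (norm h)\<^sup>2 / 4 - s * w\<^sup>2 / (4 * \<mu>\<^sup>2)) \<le> (K + (3 * w + 1) / (12 * \<mu>\<^sup>2)) * t\<^sup>2"
      using le lo unfolding right_diff_distrib distrib_right diff_divide_distrib by linarith
  qed
  then show ?thesis unfolding nh \<mu>_def[symmetric] by (simp add: power_divide algebra_simps)
qed

text \<open>If Mt(u) > 0, moving \<open>w\<close> up and down gives r = w / Mt(u). At w = 0 only the
  upward move is available, but it already forces r = 0. If Mt(u) = 0, a positive \<open>w\<close>
  would make the maximal value minus infinity.\<close>

lemma dual_max_w_eq:
  fixes F :: "nat \<Rightarrow> real ^ 'n \<Rightarrow> real"
  assumes smooth: "\<And>i. i \<le> m \<Longrightarrow> twice_cont_diff (F i)"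
    and M: "\<And>i. i \<le> m \<Longrightarrow> 0 \<le> M i" and M_pos: "\<exists>i\<le>m. 0 < M i"
    and D: "(u, w) \<in> dual_dom m F xk"
    and max: "\<And>u' w'. (u', w') \<in> dual_dom m F xk \<Longrightarrow> beta m F M xk u' w' \<le> beta m F M xk u w"
  shows "w = norm (x_of m F xk u w - xk) * Mt m M u"
proof -
  define r where "r = norm (x_of m F xk u w - xk)"
  have u: "u \<in> multipliers m" and w: "w \<ge> 0" and pd: "pos_def (Hu m F xk u w)"
    using D by (auto simp: dual_dom_def)
  show ?thesis
  proof (cases "Mt m M u = 0")
    case False
    then have Mt: "Mt m M u > 0" using Mt_nonneg[where M = M, OF M u] by simp
    have 1: "r\<^sup>2 \<le> (w / Mt m M u)\<^sup>2"
      using dual_max_w_direction[OF D Mt max, of 1 1] w by (simp add: r_def)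
    have 2: "(w / Mt m M u)\<^sup>2 \<le> r\<^sup>2"
    proof (cases "w = 0")
      case False
      then show ?thesis
        using dual_max_w_direction[OF D Mt max, of "-1" w] w by (simp add: r_def)
    qed simp
    have "r = w / Mt m M u"
      using 1 2 w Mt by (intro power2_eq_imp_eq[OF antisym]) (auto simp: r_def)
    then show ?thesis using Mt by (simp add: r_def)
  next
    case True
    have "w = 0"
    proof (rule ccontr)
      assume "w \<noteq> 0"
      \<comment> \<open>Direction towards the all-ones multiplier, whose \<open>Mt\<close> is
        positive. A small step keeps \<open>Hu\<close> positive definite and makes the dual value
        finite, contradicting maximality.\<close>
      define d where "d = (\<lambda>i. 1 - u i)"
      have one: "(\<lambda>_. 1) \<in> multipliers m" by (simp add: multipliers_def)
      obtain i where "i \<le> m" "0 < M i" using M_pos by blast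
      then have "0 < Mt m M (\<lambda>_. 1)" using M by (auto simp: Mt_def intro!: sum_pos2)
      then have Md: "Mt m M d > 0"
        using Mt_add_scaled[of m M u 1 d] True by (simp add: d_def)
      have tr: "transpose (Hu m F xk d 0) = Hu m F xk d 0" using smooth by (rule transpose_Hu)
      obtain k \<delta> where "k > 0" and \<delta>: "\<delta> > 0"
        and pdt: "\<And>t. 0 \<le> t \<Longrightarrow> t \<le> \<delta> \<Longrightarrow> pos_def (Hu m F xk u w + t *\<^sub>R Hu m F xk d 0)"
        and "\<And>t v. 0 \<le> t \<Longrightarrow> t \<le> \<delta> \<Longrightarrow>
          k * (norm v)\<^sup>2 \<le> ((Hu m F xk u w + t *\<^sub>R Hu m F xk d 0) *v v) \<bullet> v"
        by (rule pos_def_perturb[OF pd tr]) (rule that)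
      define t where "t = min \<delta> 1"
      have t: "0 < t" "t \<le> \<delta>" "t \<le> 1" using \<delta> by (auto simp: t_def)
      define u' where "u' = (\<lambda>i. u i + t * d i)"
      have "u' \<in> multipliers m"
        using multipliers_convex[OF u one] t by (simp add: u'_def d_def)
      moreover have "Hu m F xk u' w = Hu m F xk u w + t *\<^sub>R Hu m F xk d 0"
        using Hu_add_scaled[of m F xk u t d w 0] by (simp add: u'_def)
      ultimately have "(u', w) \<in> dual_dom m F xk"
        using pdt[of t] t w by (simp add: dual_dom_def)
      then have "beta m F M xk u' w \<le> beta m F M xk u w" by (rule max)
      moreover have "Mt m M u' \<noteq> 0"
        using t Md True by (simp add: u'_def Mt_add_scaled)
      ultimately show False
        using \<open>w \<noteq> 0\<close> w True by (simp add: beta_regular beta_degenerate)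
    qed
    with True show ?thesis by simp
  qed
qed

lemma dual_max_theta_le:
  fixes F :: "nat \<Rightarrow> real ^ 'n \<Rightarrow> real"
  assumes smooth: "\<And>i. i \<le> m \<Longrightarrow> twice_cont_diff (F i)"
    and M: "\<And>i. i \<le> m \<Longrightarrow> 0 \<le> M i"
    and D: "(u, w) \<in> dual_dom m F xk"
    and max: "\<And>u' w'. (u', w') \<in> dual_dom m F xk \<Longrightarrow> beta m F M xk u' w' \<le> beta m F M xk u w"
    and w_eq: "w = norm (x_of m F xk u w - xk) * Mt m M u"
    and u': "u' \<in> multipliers m"
  shows "theta m F M xk (x_of m F xk u w) u' \<le> theta m F M xk (x_of m F xk u w) u"
proof -
  define A where "A = Hu m F xk u w"
  define b where "b = gu m F xk u"
  define h where "h = - (matrix_inv A *v b)"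
  define r where "r = norm (x_of m F xk u w - xk)"
  define d where "d = (\<lambda>i. u' i - u i)"
  \<comment> \<open>Slope of \<open>Hu\<close> along the path u + t d with w = r Mt(u + t d); this
    path is affine in \<open>t\<close>.\<close>
  define B where "B = Hu m F xk d (r * Mt m M d)"
  define c where "c = gu m F xk d"
  have xh: "x_of m F xk u w - xk = h" by (simp add: x_of_minus h_def A_def b_def)
  have wr: "w = r * Mt m M u" using w_eq by (simp add: r_def)
  have u: "u \<in> multipliers m" and pd: "pos_def A"
    using D by (auto simp: dual_dom_def A_def)
  have tr: "transpose B = B" unfolding B_def by (rule transpose_Hu[OF smooth])
  obtain K \<delta> where \<delta>: "\<delta> > 0"
    and pdt: "\<And>t. 0 \<le> t \<Longrightarrow> t \<le> \<delta> \<Longrightarrow> pos_def (A + t *\<^sub>R B)"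
    and Vt: "\<And>t. 0 \<le> t \<Longrightarrow> t \<le> \<delta> \<Longrightarrow>
      - 1/2 * ((matrix_inv A *v b) \<bullet> b) + t * (c \<bullet> h + 1/2 * ((B *v h) \<bullet> h)) - K * t\<^sup>2
      \<le> - 1/2 * ((matrix_inv (A + t *\<^sub>R B) *v (b + t *\<^sub>R c)) \<bullet> (b + t *\<^sub>R c))"
    by (rule quadratic_min_perturb[OF pd tr, where b = b and c = c, folded h_def]) (rule that)
  have "lu m F xk d + (c \<bullet> h + 1/2 * ((B *v h) \<bullet> h)) - r ^ 3 * Mt m M d / 12 \<le> 0"
  proof (rule nonpos_of_quadratic_bound)
    show "min 1 \<delta> > 0" using \<delta> by simp
    fix t :: real assume t: "0 < t" "t \<le> min 1 \<delta>"
    define ut where "ut = (\<lambda>i. u i + t * d i)"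
    have ut: "ut \<in> multipliers m"
      using multipliers_convex[OF u u', of t] t by (simp add: ut_def d_def)
    have Mut: "Mt m M ut = Mt m M u + t * Mt m M d" by (simp add: ut_def Mt_add_scaled)
    have Hut: "Hu m F xk ut (r * Mt m M ut) = A + t *\<^sub>R B"
      unfolding A_def B_def Hu_add_scaled[symmetric] by (simp add: ut_def Mt_add_scaled wr algebra_simps)
    have "(ut, r * Mt m M ut) \<in> dual_dom m F xk"
      using t ut pdt[of t] Mt_nonneg[where M = M, OF M ut] by (simp add: dual_dom_def Hut) (simp add: r_def)
    from max[OF this] have "beta m F M xk ut (r * Mt m M ut) \<le> beta m F M xk u (r * Mt m M u)"
      by (simp add: wr)
    then have "lu m F xk ut - 1/2 * ((matrix_inv (A + t *\<^sub>R B) *v (b + t *\<^sub>R c)) \<bullet> (b + t *\<^sub>R c))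
        - r ^ 3 * Mt m M ut / 12
      \<le> lu m F xk u - 1/2 * ((matrix_inv A *v b) \<bullet> b) - r ^ 3 * Mt m M u / 12"
      unfolding beta_proportional Hut
      by (simp add: A_def wr b_def c_def ut_def gu_add_scaled)
    with Vt[of t] t show "t * (lu m F xk d + (c \<bullet> h + 1/2 * ((B *v h) \<bullet> h)) - r ^ 3 * Mt m M d / 12) \<le> K * t\<^sup>2"
      by (simp add: ut_def lu_add_scaled Mt_add_scaled algebra_simps add_divide_distrib)
  qed
  \<comment> \<open>Since |h| = r, the terms - r^3 Mt(d) / 4 and r^3 Mt(d) / 6 from
    \<open>theta_eq_Hu\<close> combine to - r^3 Mt(d) / 12.\<close>
  also have "lu m F xk d + (c \<bullet> h + 1/2 * ((B *v h) \<bullet> h)) - r ^ 3 * Mt m M d / 12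
    = theta m F M xk (x_of m F xk u w) d"
    unfolding theta_eq_Hu[where w = "r * Mt m M d"] xh B_def c_def r_def
    by (simp add: power2_eq_square power3_eq_cube algebra_simps)
  finally show ?thesis
    using theta_add_scaled[of m F M xk "x_of m F xk u w" u 1 d] by (simp add: d_def)
qed

section \<open>Strong and weak duality\<close>

text \<open>The point x(u, w) of a dual maximizer is the primal witness: \<open>u\<close> attains
  its inner maximum, and w = r Mt(u) closes the gap.\<close>

lemma strong_duality:
  fixes F :: "nat \<Rightarrow> real ^ 'n \<Rightarrow> real"
  assumes smooth: "\<And>i. i \<le> m \<Longrightarrow> twice_cont_diff (F i)"
    and M: "\<And>i. i \<le> m \<Longrightarrow> 0 \<le> M i" and M_pos: "\<exists>i\<le>m. 0 < M i"
    and D: "(u, w) \<in> dual_dom m F xk"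
    and max: "\<And>u' w'. (u', w') \<in> dual_dom m F xk \<Longrightarrow> beta m F M xk u' w' \<le> beta m F M xk u w"
  shows "theta_star m F M xk \<le> beta_star m F M xk"
proof -
  define x where "x = x_of m F xk u w"
  define r where "r = norm (x - xk)"
  have pd: "pos_def (Hu m F xk u w)" using D by (simp add: dual_dom_def)
  have w_eq: "w = r * Mt m M u"
    unfolding r_def x_def by (rule dual_max_w_eq[OF smooth M M_pos D max])
  have "theta_star m F M xk \<le> primal_fun m F M xk x"
    unfolding theta_star_def by (rule INF_lower) simp
  also have "\<dots> \<le> ereal (theta m F M xk x u)"
    unfolding primal_fun_def x_def
    by (rule SUP_least, simp, rule dual_max_theta_le[OF smooth M D max])
       (use w_eq in \<open>simp_all add: r_def x_def\<close>)
  \<comment> \<open>The proportional form of \<open>beta\<close> is used because it also covers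
    Mt(u) = 0, where \<open>duality_gap\<close> does not apply.\<close>
  also have "\<dots> = beta m F M xk u (r * Mt m M u)"
    unfolding beta_proportional x_def theta_x_of[OF pd]
    by (simp add: w_eq[symmetric] flip: r_def x_def)
       (simp add: w_eq power2_eq_square power3_eq_cube)
  also have "\<dots> = beta m F M xk u w" by (simp add: w_eq)
  also have "\<dots> \<le> beta_star m F M xk"
    unfolding beta_star_def using D by (rule SUP_upper2) simp
  finally show ?thesis .
qed

lemma weak_duality:
  assumes M: "\<And>i. i \<le> m \<Longrightarrow> 0 \<le> M i"
  shows "beta_star m F M xk \<le> theta_star m F M xk"
proof -
  have "beta m F M xk u w \<le> primal_fun m F M xk x" if D: "(u, w) \<in> dual_dom m F xk" for u w x
  proof -
    have "beta m F M xk u w \<le> ereal (theta m F M xk x u)"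
      using M D by (rule beta_le_theta)
    also have "\<dots> \<le> primal_fun m F M xk x"
      unfolding primal_fun_def using D by (intro SUP_upper) (simp add: dual_dom_def)
    finally show ?thesis .
  qed
  then show ?thesis
    unfolding beta_star_def theta_star_def by (auto intro!: SUP_least INF_greatest)
qed

section \<open>Attainment of the primal minimum\<close>

lemma theta_sublevel_bounded:
  fixes F :: "nat \<Rightarrow> real ^ 'n \<Rightarrow> real"
  assumes "Mt m M u > 0"
  shows "bounded {x. theta m F M xk x u \<le> a}"
proof -
  define \<mu> where "\<mu> = Mt m M u / 6"
  have \<mu>: "\<mu> > 0" using assms by (simp add: \<mu>_def)
  obtain K where K: "K \<ge> 0" "\<And>v. \<bar>((Hu m F xk u 0) *v v) \<bullet> v\<bar> \<le> K * (norm v)\<^sup>2"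
    using quadratic_form_bounded by blast
  \<comment> \<open>For r > 1 every lower-order term is bounded by its coefficient times r^2, so
    \<mu> r^3 \<le> C r^2 and r cannot exceed C / \<mu>.\<close>
  define C where "C = \<bar>a - lu m F xk u\<bar> + norm (gu m F xk u) + K"
  have "norm (x - xk) \<le> max 1 (C / \<mu>)" if x: "theta m F M xk x u \<le> a" for x
  proof (rule ccontr)
    assume far: "\<not> norm (x - xk) \<le> max 1 (C / \<mu>)"
    define r where "r = norm (x - xk)"
    have r: "r > 1" "\<mu> * r > C" using far \<mu> by (simp_all add: r_def not_le pos_divide_less_eq mult.commute)
    have r2: "1 \<le> r\<^sup>2" "r \<le> r\<^sup>2" using r by (auto simp: power2_eq_square intro: mult_mono[of 1 r 1 r, simplified])
    have "\<bar>gu m F xk u \<bullet> (x - xk)\<bar> \<le> norm (gu m F xk u) * r"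
      using Cauchy_Schwarz_ineq2 by (simp add: r_def)
    also have "\<dots> \<le> norm (gu m F xk u) * r\<^sup>2" using r2 by (intro mult_left_mono) auto
    finally have g: "\<bar>gu m F xk u \<bullet> (x - xk)\<bar> \<le> norm (gu m F xk u) * r\<^sup>2" .
    have "\<bar>a - lu m F xk u\<bar> \<le> \<bar>a - lu m F xk u\<bar> * r\<^sup>2"
      using mult_left_mono[OF r2(1), of "\<bar>a - lu m F xk u\<bar>"] by simp
    moreover have "\<mu> * r ^ 3 \<le> (a - lu m F xk u) - gu m F xk u \<bullet> (x - xk)
        - 1/2 * ((Hu m F xk u 0 *v (x - xk)) \<bullet> (x - xk))"
      using x unfolding theta_eq_Hu[where w = 0] by (simp add: \<mu>_def r_def)
    moreover have "\<bar>(Hu m F xk u 0 *v (x - xk)) \<bullet> (x - xk)\<bar> \<le> K * r\<^sup>2"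
      using K(2)[of "x - xk"] by (simp add: r_def)
    moreover have "0 \<le> K * r\<^sup>2" using K by simp
    ultimately have "\<mu> * r ^ 3 \<le> C * r\<^sup>2"
      using g by (simp add: C_def algebra_simps)
    then have "\<mu> * r * r\<^sup>2 \<le> C * r\<^sup>2" by (simp add: power2_eq_square power3_eq_cube mult_ac)
    then show False using r by (simp add: mult_le_cancel_right)
  qed
  then have "{x. theta m F M xk x u \<le> a} \<subseteq> cball xk (max 1 (C / \<mu>))"
    by (auto simp: dist_norm norm_minus_commute)
  then show ?thesis by (rule bounded_subset[OF bounded_cball])
qed

lemma primal_sublevel_compact:
  fixes F :: "nat \<Rightarrow> real ^ 'n \<Rightarrow> real"
  assumes M: "\<And>i. i \<le> m \<Longrightarrow> 0 \<le> M i" and M_pos: "\<exists>i\<le>m. 0 < M i"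
  shows "compact {x. primal_fun m F M xk x \<le> ereal a}"
proof -
  have eq: "{x. primal_fun m F M xk x \<le> ereal a} = (\<Inter>u\<in>multipliers m. {x. theta m F M xk x u \<le> a})"
    by (auto simp: primal_fun_def SUP_le_iff)
  have "closed {x. theta m F M xk x u \<le> a}" for u
    unfolding theta_def
    by (intro closed_Collect_le continuous_intros
        linear_continuous_on_compose[OF _ bounded_linear.linear[OF matrix_vector_mul_bounded_linear]])
  moreover have "bounded (\<Inter>u\<in>multipliers m. {x. theta m F M xk x u \<le> a})"
  proof -
    \<comment> \<open>One multiplier with positive \<open>Mt\<close> bounds the whole intersection;
      all ones works whichever \<open>M i\<close> is positive.\<close>
    have "0 < Mt m M (\<lambda>_. 1)" using M M_pos by (auto simp: Mt_def intro!: sum_pos2)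
    then show ?thesis
      by (rule bounded_subset[OF theta_sublevel_bounded]) (auto simp: multipliers_def)
  qed
  ultimately show ?thesis
    unfolding eq compact_eq_bounded_closed by (auto intro: closed_INT)
qed

text \<open>Weierstrass by the finite intersection property: among finitely many sublevel sets the
  smallest lies in all others. Levels at infinity are left out, and if f is infinite everywhere (an
  infeasible problem) any point is minimal.\<close>

lemma ereal_attains_min:
  fixes f :: "'a::t2_space \<Rightarrow> ereal"
  assumes compact: "\<And>a. compact {x. f x \<le> ereal a}" and bot: "\<And>x. f x \<noteq> -\<infinity>"
  shows "\<exists>x. \<forall>y. f x \<le> f y"
proof (cases "\<forall>x. f x = \<infinity>")
  case True
  then show ?thesis by simp
next
  case False
  then obtain x0 where x0: "f x0 \<noteq> \<infinity>" by blast
  define S where "S y = {x. f x \<le> f y}" for y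
  have comp: "compact (S y)" if "f y \<noteq> \<infinity>" for y
    using compact[of "real_of_ereal (f y)"] bot[of y] that by (cases "f y") (auto simp: S_def)
  have "S x0 \<inter> (\<Inter>y\<in>{y. f y \<noteq> \<infinity>}. S y) \<noteq> {}"
  proof (rule compact_imp_fip_image)
    show "compact (S x0)" using comp[OF x0] .
    show "closed (S y)" if "y \<in> {y. f y \<noteq> \<infinity>}" for y
      using comp that by (simp add: compact_imp_closed)
    fix I assume I: "finite I" "I \<subseteq> {y. f y \<noteq> \<infinity>}"
    obtain z where "z \<in> insert x0 I" "\<And>y. y \<in> insert x0 I \<Longrightarrow> f z \<le> f y"
      using ex_min_if_finite[of "f ` insert x0 I"] I(1) by (auto simp: not_less)
    then have "z \<in> S x0 \<inter> (\<Inter>y\<in>I. S y)" by (auto simp: S_def)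
    then show "S x0 \<inter> (\<Inter>y\<in>I. S y) \<noteq> {}" by blast
  qed
  then obtain x where "\<And>y. f y \<noteq> \<infinity> \<Longrightarrow> f x \<le> f y" by (auto simp: S_def)
  then have "f x \<le> f y" for y by (cases "f y = \<infinity>") auto
  then show ?thesis by blast
qed

lemma primal_attained:
  fixes F :: "nat \<Rightarrow> real ^ 'n \<Rightarrow> real"
  assumes M: "\<And>i. i \<le> m \<Longrightarrow> 0 \<le> M i" and M_pos: "\<exists>i\<le>m. 0 < M i"
  shows "\<exists>x. is_arg_min (primal_fun m F M xk) (\<lambda>_. True) x"
proof -
  have "primal_fun m F M xk x \<noteq> -\<infinity>" for x
  proof -
    have "ereal (theta m F M xk x (\<lambda>_. 1)) \<le> primal_fun m F M xk x"
      unfolding primal_fun_def by (rule SUP_upper) (simp add: multipliers_def)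
    then show ?thesis by auto
  qed
  then show ?thesis
    using ereal_attains_min[OF primal_sublevel_compact[OF M M_pos]]
    by (fastforce simp: is_arg_min_def not_less)
qed

text \<open>Positive definiteness makes the dual domain non-closed, so a dual maximizer may fail to
  exist: on the line with m = 0, xk = 0 and F_0(x) = - x^2 / 2, the domain is w > 2 and
  \<open>beta\<close> increases as w decreases to 2. Equality is therefore stated conditionally on a
  dual maximizer. The guard on \<open>Mu\<close> matters: division by zero would make the closed
  form 0, while the gap is infinite for w > 0.\<close>

theorem theorem6p1:
  fixes F :: "nat \<Rightarrow> real ^ 'n \<Rightarrow> real"
    and M :: "nat \<Rightarrow> real"
    and m :: nat
    and xk :: "real ^ 'n"
  assumes smooth: "\<And>i. i \<le> m \<Longrightarrow> twice_cont_diff (F i)"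
    and M_nonneg: "\<And>i. i \<le> m \<Longrightarrow> 0 \<le> M i"
    and M_pos: "\<exists>i\<le>m. 0 < M i"
  shows
    "(\<exists>x. is_arg_min (primal_fun m F M xk) (\<lambda>_. True) x)
     \<and> beta_star m F M xk \<le> theta_star m F M xk
     \<and> ((\<exists>p. is_arg_max (\<lambda>(u, w). beta m F M xk u w) (\<lambda>p. p \<in> dual_dom m F xk) p)
          \<longrightarrow> theta_star m F M xk = beta_star m F M xk)
     \<and> (\<forall>u w. (u, w) \<in> dual_dom m F xk \<longrightarrow>
          (let x = x_of m F xk u w; r = norm (x - xk); Mu = Mt m M u in
             0 \<le> ereal (theta m F M xk x u) - beta m F M xk u w
             \<and> (Mu \<noteq> 0 \<longrightarrow>
                  ereal (theta m F M xk x u) - beta m F M xk u w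
                    = ereal (Mu / 12 * (w / Mu + 2 * r) * (r - w / Mu)\<^sup>2))))"
proof (intro conjI)
  show "\<exists>x. is_arg_min (primal_fun m F M xk) (\<lambda>_. True) x"
    using M_nonneg M_pos by (rule primal_attained)
  show weak: "beta_star m F M xk \<le> theta_star m F M xk"
    using M_nonneg by (rule weak_duality)
  show "(\<exists>p. is_arg_max (\<lambda>(u, w). beta m F M xk u w) (\<lambda>p. p \<in> dual_dom m F xk) p)
          \<longrightarrow> theta_star m F M xk = beta_star m F M xk"
  proof
    assume "\<exists>p. is_arg_max (\<lambda>(u, w). beta m F M xk u w) (\<lambda>p. p \<in> dual_dom m F xk) p"
    then obtain u w where "(u, w) \<in> dual_dom m F xk"
      "\<And>u' w'. (u', w') \<in> dual_dom m F xk \<Longrightarrow> beta m F M xk u' w' \<le> beta m F M xk u w"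
      by (fastforce simp: is_arg_max_def not_less)
    from strong_duality[OF smooth M_nonneg M_pos this] weak
    show "theta_star m F M xk = beta_star m F M xk" by simp
  qed
  show "\<forall>u w. (u, w) \<in> dual_dom m F xk \<longrightarrow>
          (let x = x_of m F xk u w; r = norm (x - xk); Mu = Mt m M u in
             0 \<le> ereal (theta m F M xk x u) - beta m F M xk u w
             \<and> (Mu \<noteq> 0 \<longrightarrow>
                  ereal (theta m F M xk x u) - beta m F M xk u w
                    = ereal (Mu / 12 * (w / Mu + 2 * r) * (r - w / Mu)\<^sup>2)))"
    unfolding Let_def
  proof (intro allI impI conjI)
    fix u w assume D: "(u, w) \<in> dual_dom m F xk"
    show "0 \<le> ereal (theta m F M xk (x_of m F xk u w) u) - beta m F M xk u w"
      using beta_le_theta[where M = M, OF M_nonneg D]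
      by (cases "beta m F M xk u w") (auto simp flip: zero_ereal_def)
    assume "Mt m M u \<noteq> 0"
    with D show "ereal (theta m F M xk (x_of m F xk u w) u) - beta m F M xk u w
      = ereal (Mt m M u / 12 * (w / Mt m M u + 2 * norm (x_of m F xk u w - xk))
          * (norm (x_of m F xk u w - xk) - w / Mt m M u)\<^sup>2)"
      by (intro duality_gap) (simp add: dual_dom_def)
  qed
qed

end
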